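(* Let $\pi$ be a normal proof with $\mathrm{axioms}(\pi)\subseteq X$ and $\mathrm{conc}(\pi)=t$. Then $\mathrm{terms}(\pi)\subseteq \mathrm{st}(X\cup\{t\})$. Further, if $\mathrm{lr}(\pi)$ is a destructor rule, then $\mathrm{terms}(\pi)\subseteq\mathrm{st}(X)$.
   Context: Terms: fix a set $N$ of names containing distinguished names $0$ and $\mathsf{secret}$, keys $\mathcal{K}\subseteq N$, variables $V$. Terms: $t,t' ::= x \mid m \mid \mathsf{pk}(k) \mid \mathsf{pair}(t,t') \mid \mathsf{senc}(t,t') \mid \mathsf{aenc}(t,\mathsf{pk}(k)) \mid \bigoplus M$ ($x\in V$, $m\in N$, $k\in\mathcal K$, $M$ a finite multiset of terms); $t_1\oplus\cdots\oplus t_n:=\bigoplus\{t_1,\dots,t_n\}$. Terms $\bigoplus M$ are non-standard, others standard; $\bigoplus\{t\}:=t$ for standard $t$, $\bigoplus\emptyset:=0$. Factors: $\mathrm{fac}(t)=\{t\}$ for standard $t$; $\mathrm{fac}(\bigoplus M)=$ multiset union of $\mathrm{fac}(u)$, $u\in M$. Subterms: $\mathrm{st}(a)=\{a\}$ for $a\in N\cup V$; $\mathrm{st}(\mathsf{pk}(k))=\{\mathsf{pk}(k),k\}$; $\mathrm{st}(\mathsf f(u,v))=\{\mathsf f(u,v)\}\cup\mathrm{st}(u)\cup\mathrm{st}(v)$ for $\mathsf f\in\{\mathsf{pair},\mathsf{senc},\mathsf{aenc}\}$; $\mathrm{st}(r)=\{r\}\cup\bigcup_{u\in\mathrm{fac}(r)}\mathrm{st}(u)$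 for non-standard $r$; $\mathrm{st}(X)=\bigcup_{t\in X}\mathrm{st}(t)$. Normal form: $\mathrm{nf}(a)=a$ for $a\in N\cup V$; $\mathrm{nf}(\mathsf{pk}(k))=\mathsf{pk}(k)$; $\mathrm{nf}(\mathsf f(u,v))=\mathsf f(\mathrm{nf}(u),\mathrm{nf}(v))$; for non-standard $r$, $\mathrm{nf}(r)=\bigoplus\{v\mid \sum_{u:\mathrm{nf}(u)=v}\#_u(\mathrm{fac}(r))\text{ odd}\}$ ($\#_u$ counts occurrences). Normalized: $\mathrm{nf}(t)=t$. Rules: $\mathsf{ax}$ (no premises); $\mathsf{split}$: $\mathsf{pair}(t_1,t_2)\Rightarrow t_i$; $\mathsf{sdec}$: $\mathsf{senc}(u,v), v\Rightarrow u$; $\mathsf{adec}$: $\mathsf{aenc}(u,\mathsf{pk}(k)), k\Rightarrow u$; $\mathsf{pk}$: $k\Rightarrow\mathsf{pk}(k)$; $\mathsf{pair}$: $u,v\Rightarrow\mathsf{pair}(u,v)$; $\mathsf{senc}$: $u,v\Rightarrow\mathsf{senc}(u,v)$; $\mathsf{aenc}$: $u,\mathsf{pk}(k)\Rightarrow\mathsf{aenc}(u,\mathsf{pk}(k))$; $\mathsf{xor}$: $t_1,\dots,t_n\Rightarrow\mathrm{nf}(t_1\oplus\cdots\oplus t_n)$. Destructors: $\mathsf{ax},\mathsf{split},\mathsf{sdec},\mathsf{adec}$, and $\mathsf{xor}$ with standard conclusion ($\mathsf{xor}_d$); constructors: $\mathsf{pk},\mathsf{pair},\mathsf{senc},\mathsf{aenc}$,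 and $\mathsf{xor}$ with non-standard conclusion ($\mathsf{xor}_c$). A proof is a finite tree with nodes labelled $(t,\mathsf r)$, $t$ normalized, leaves labelled $\mathsf{ax}$, each node an instance of its rule with its children's terms as premises. $\mathrm{conc}(\pi)$, $\mathrm{lr}(\pi)$: root term and rule; $\mathrm{axioms}(\pi)$: set of leaf terms; $\mathrm{terms}(\pi)$: set of all terms labelling nodes of $\pi$. A proof is normal if (1) no $\mathsf{split},\mathsf{sdec},\mathsf{adec}$ occurrence has leftmost premise concluded by a constructor rule; (2) in every $\mathsf{xor}$ occurrence, no two premises are equal, no premise equals the conclusion, and no premise is the conclusion of $\mathsf{xor}$. *)

theory Defs
  imports "HOL-Library.Multiset"
begin

text \<open>The set \<open>N\<close> of names is the universe of a type of class \<open>names\<close>; the set of keys is an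
  explicit parameter \<open>K :: 'n set\<close>; variables are the elements of an arbitrary type \<open>'v\<close>.\<close>

class names = zero +
  fixes secret :: 'a
  assumes secret_neq_zero: "secret \<noteq> 0"

text \<open>Raw terms. \<open>TAEnc t k\<close> stands for \<open>aenc(t, pk(k))\<close>. The conventions \<open>\<Oplus>{t} := t\<close> (\<open>t\<close> standard)
  and \<open>\<Oplus>\<emptyset> := 0\<close> are imposed by building sums with \<open>xor_sum\<close> below and by excluding
  \<open>TXor {#}\<close> and \<open>TXor {#t#}\<close> (\<open>t\<close> standard) from the set \<open>wf_terms K\<close> of terms proper.\<close>

datatype ('n, 'v) trm =
    TVar 'v
  | TName 'n
  | TPk 'n
  | TPair "('n, 'v) trm" "('n, 'v) trm"
  | TSEnc "('n, 'v) trm" "('n, 'v) trm"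
  | TAEnc "('n, 'v) trm" 'n
  | TXor "('n, 'v) trm multiset"

text \<open>The name \<open>0\<close> is the empty sum \<open>\<Oplus>\<emptyset>\<close>, so it is non-standard and has no factors. (If \<open>0\<close> counted
  as standard, it would not be neutral for \<open>\<oplus>\<close>: \<open>0 \<oplus> a\<close> would be in normal form.)\<close>

fun standard :: "('n::names, 'v) trm \<Rightarrow> bool" where
  "standard (TName m) \<longleftrightarrow> m \<noteq> 0"
| "standard (TXor M) \<longleftrightarrow> False"
| "standard _ \<longleftrightarrow> True"

definition xor_sum :: "('n::names, 'v) trm multiset \<Rightarrow> ('n, 'v) trm" where
  "xor_sum M =
     (if M = {#} then TName 0
      else if \<exists>t. standard t \<and> M = {#t#} then THE t. M = {#t#}
      else TXor M)"

inductive_set wf_terms :: "'n::names set \<Rightarrow> ('n, 'v) trm set" for K :: "'n set" where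
  "TVar x \<in> wf_terms K"
| "TName m \<in> wf_terms K"
| "k \<in> K \<Longrightarrow> TPk k \<in> wf_terms K"
| "t \<in> wf_terms K \<Longrightarrow> t' \<in> wf_terms K \<Longrightarrow> TPair t t' \<in> wf_terms K"
| "t \<in> wf_terms K \<Longrightarrow> t' \<in> wf_terms K \<Longrightarrow> TSEnc t t' \<in> wf_terms K"
| "t \<in> wf_terms K \<Longrightarrow> k \<in> K \<Longrightarrow> TAEnc t k \<in> wf_terms K"
| "\<forall>u \<in> set_mset M. u \<in> wf_terms K \<Longrightarrow> xor_sum M \<in> wf_terms K"

primrec fac :: "('n::names, 'v) trm \<Rightarrow> ('n, 'v) trm multiset" where
  "fac (TVar x) = {#TVar x#}"
| "fac (TName m) = (if m = 0 then {#} else {#TName m#})"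
| "fac (TPk k) = {#TPk k#}"
| "fac (TPair u v) = {#TPair u v#}"
| "fac (TSEnc u v) = {#TSEnc u v#}"
| "fac (TAEnc u k) = {#TAEnc u k#}"
| "fac (TXor M) = \<Sum>\<^sub># (image_mset fac M)"

lemma size_fac: "u \<in># fac t \<Longrightarrow> size u \<le> size t"
proof (induction t)
  case (TXor M)
  then obtain s where s: "s \<in># M" "u \<in># fac s" by auto
  have "size s \<le> size_multiset size M"
    using s(1) by (auto dest!: multi_member_split)
  with TXor.IH[OF s] show ?case by simp
qed (auto split: if_splits)

lemma size_fac_TXor: "u \<in># fac (TXor M) \<Longrightarrow> size u < size (TXor M)"
proof -
  assume "u \<in># fac (TXor M)"
  then obtain s where s: "s \<in># M" "u \<in># fac s" by auto
  have "size s \<le> size_multiset size M"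
    using s(1) by (auto dest!: multi_member_split)
  with size_fac[OF s(2)] show ?thesis by simp
qed

function (sequential) st :: "('n::names, 'v) trm \<Rightarrow> ('n, 'v) trm set" where
  "st (TVar x) = {TVar x}"
| "st (TName m) = {TName m}"
| "st (TPk k) = {TPk k, TName k}"
| "st (TPair u v) = {TPair u v} \<union> st u \<union> st v"
| "st (TSEnc u v) = {TSEnc u v} \<union> st u \<union> st v"
| "st (TAEnc u k) = {TAEnc u k} \<union> st u \<union> {TPk k, TName k}"
| "st (TXor M) = {TXor M} \<union> (\<Union>u \<in> set_mset (fac (TXor M)). st u)"
  by pat_completeness auto
termination
  by (relation "measure size") (auto simp del: fac.simps dest: size_fac_TXor)

definition sts :: "('n::names, 'v) trm set \<Rightarrow> ('n, 'v) trm set" where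
  "sts X = (\<Union>t \<in> X. st t)"

function (sequential) nf :: "('n::names, 'v) trm \<Rightarrow> ('n, 'v) trm" where
  "nf (TVar x) = TVar x"
| "nf (TName m) = TName m"
| "nf (TPk k) = TPk k"
| "nf (TPair u v) = TPair (nf u) (nf v)"
| "nf (TSEnc u v) = TSEnc (nf u) (nf v)"
| "nf (TAEnc u k) = TAEnc (nf u) k"
| "nf (TXor M) =
     xor_sum (mset_set {v. odd (\<Sum>u \<in> set_mset (fac (TXor M)).
                                  if nf u = v then count (fac (TXor M)) u else 0)})"
  by pat_completeness auto
termination
  by (relation "measure size") (auto simp del: fac.simps dest: size_fac_TXor)

definition normalized :: "('n::names, 'v) trm \<Rightarrow> bool" where
  "normalized t \<longleftrightarrow> nf t = t"

datatype rule = R_ax | R_split | R_sdec | R_adec | R_pk | R_pair | R_senc | R_aenc | R_xor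

inductive rule_instance :: "rule \<Rightarrow> ('n::names, 'v) trm list \<Rightarrow> ('n, 'v) trm \<Rightarrow> bool" where
  "rule_instance R_ax [] t"
| "rule_instance R_split [TPair t1 t2] t1"
| "rule_instance R_split [TPair t1 t2] t2"
| "rule_instance R_sdec [TSEnc u v, v] u"
| "rule_instance R_adec [TAEnc u k, TName k] u"
| "rule_instance R_pk [TName k] (TPk k)"
| "rule_instance R_pair [u, v] (TPair u v)"
| "rule_instance R_senc [u, v] (TSEnc u v)"
| "rule_instance R_aenc [u, TPk k] (TAEnc u k)"
| "rule_instance R_xor ts (nf (xor_sum (mset ts)))"

definition destructor_rule :: "rule \<Rightarrow> ('n::names, 'v) trm \<Rightarrow> bool" where
  "destructor_rule r c \<longleftrightarrow> r \<in> {R_ax, R_split, R_sdec, R_adec} \<or> r = R_xor \<and> standard c"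

definition constructor_rule :: "rule \<Rightarrow> ('n::names, 'v) trm \<Rightarrow> bool" where
  "constructor_rule r c \<longleftrightarrow> r \<in> {R_pk, R_pair, R_senc, R_aenc} \<or> r = R_xor \<and> \<not> standard c"

datatype ('n, 'v) ptree =
  Node (conc: "('n, 'v) trm") (lr: rule) (children: "('n, 'v) ptree list")

fun terms :: "('n, 'v) ptree \<Rightarrow> ('n, 'v) trm set" where
  "terms (Node t r ps) = {t} \<union> (\<Union>p \<in> set ps. terms p)"

fun axioms :: "('n, 'v) ptree \<Rightarrow> ('n, 'v) trm set" where
  "axioms (Node t r ps) = (if ps = [] then {t} else (\<Union>p \<in> set ps. axioms p))"

fun is_proof :: "'n::names set \<Rightarrow> ('n, 'v) ptree \<Rightarrow> bool" where
  "is_proof K (Node t r ps) \<longleftrightarrow>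
     t \<in> wf_terms K \<and> normalized t \<and> (ps = [] \<longrightarrow> r = R_ax) \<and>
     rule_instance r (map conc ps) t \<and> (\<forall>p \<in> set ps. is_proof K p)"

fun normal :: "('n::names, 'v) ptree \<Rightarrow> bool" where
  "normal (Node t r ps) \<longleftrightarrow>
     (r \<in> {R_split, R_sdec, R_adec} \<longrightarrow> \<not> constructor_rule (lr (hd ps)) (conc (hd ps))) \<and>
     (r = R_xor \<longrightarrow> distinct (map conc ps) \<and> t \<notin> set (map conc ps) \<and> (\<forall>p \<in> set ps. lr p \<noteq> R_xor)) \<and>
     (\<forall>p \<in> set ps. normal p)"

end

theory Submission imports Defs begin

text \<open>By induction on the proof tree. The only delicate rule is \<open>xor\<close>. A premise concluded by a
  constructor is standard, because no premise of \<open>xor\<close> is concluded by \<open>xor\<close>. Hence it either survives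
  as a factor of the conclusion or cancels against a factor of another premise; as the premises are
  pairwise distinct, that other premise is non-standard, so it is concluded by a destructor and lies in
  \<open>st(X)\<close>. A standard conclusion differs from all premises, so it too is a factor of a non-standard
  premise.\<close>

section \<open>Factors and normal forms\<close>

lemma fac_eq_single_if_standard: "standard t \<Longrightarrow> fac t = {#t#}"
  by (cases t) auto

lemma standard_if_mem_fac: "u \<in># fac t \<Longrightarrow> standard u"
  by (induction t) (auto split: if_splits)

lemma standard_nf: "standard t \<Longrightarrow> standard (nf t)"
  by (cases t) auto

lemma sum_mset_image_fac_standard:
  "\<forall>u \<in># M. standard u \<Longrightarrow> \<Sum>\<^sub># (image_mset fac M) = M"
  by (induction M) (auto simp: fac_eq_single_if_standard)

text \<open>Used as a case rule, so that the \<open>THE\<close> in \<open>xor_sum\<close> is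
  unfolded only here.\<close>

lemma xor_sum_cases:
  obtains "M = {#}" "xor_sum M = TName 0"
  | t where "standard t" "M = {#t#}" "xor_sum M = t"
  | "xor_sum M = TXor M"
  by (cases "M = {#}"; cases "\<exists>t. standard t \<and> M = {#t#}") (auto simp: xor_sum_def)

lemma fac_xor_sum: "fac (xor_sum M) = \<Sum>\<^sub># (image_mset fac M)"
  by (cases M rule: xor_sum_cases) (auto simp: fac_eq_single_if_standard)

text \<open>Grouping the factors by their normal form turns the sum in \<open>nf\<close> into a
  multiplicity in an image multiset.\<close>

lemma nf_TXor:
  "nf (TXor M) = xor_sum (mset_set {v. odd (count (image_mset nf (fac (TXor M))) v)})"
proof -
  have "(\<Sum>u \<in> set_mset F. if nf u = v then count F u else 0) = count (image_mset nf F) v"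
    for F :: "('a, 'b) trm multiset" and v
    by (simp add: count_image_mset sum.If_cases Int_def vimage_def conj_commute)
  then show ?thesis by (simp del: fac.simps)
qed

lemma odd_count_imp_mem: "odd (count M v) \<Longrightarrow> v \<in># M"
  by (metis count_eq_zero_iff even_zero)

lemma finite_odd_count: "finite {v. odd (count M v)}"
  by (rule finite_subset[of _ "set_mset M"]) (auto dest: odd_count_imp_mem)

text \<open>Normal forms of factors are standard, so flattening the sum built by \<open>nf\<close>
  returns the same multiset. A standard term is its own only factor, of multiplicity 1, and
  \<open>TName 0\<close> has none; hence the formula covers every term.\<close>

lemma fac_nf: "fac (nf t) = mset_set {v. odd (count (image_mset nf (fac t)) v)}"
proof (cases "standard t")
  case True
  have "{v. odd (count {#nf t#} v)} = {nf t}" by auto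
  with True show ?thesis by (simp add: fac_eq_single_if_standard standard_nf)
next
  case False
  then consider "t = TName 0" | M where "t = TXor M" by (cases t) auto
  then show ?thesis
  proof cases
    case 1
    then show ?thesis by simp
  next
    case (2 M)
    let ?S = "{v. odd (count (image_mset nf (fac t)) v)}"
    have "\<forall>u \<in># mset_set ?S. standard u"
      by (auto simp: finite_odd_count dest!: odd_count_imp_mem
          intro!: standard_nf elim: standard_if_mem_fac)
    then show ?thesis
      unfolding 2 nf_TXor fac_xor_sum by (rule sum_mset_image_fac_standard)
  qed
qed

lemma mem_fac_nf: "v \<in># fac (nf t) \<longleftrightarrow> odd (count (image_mset nf (fac t)) v)"
  by (simp add: fac_nf finite_odd_count)

text \<open>Each element has multiplicity 1, which is odd, so nothing cancels.\<close>

lemma nf_xor_sum_mset_set: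
  assumes "finite S" "\<forall>u \<in> S. standard u \<and> nf u = u"
  shows "nf (xor_sum (mset_set S)) = xor_sum (mset_set S)"
proof (cases "mset_set S" rule: xor_sum_cases)
  case 1
  then show ?thesis by simp
next
  case (2 t)
  then have "t \<in># mset_set S" by simp
  with assms have "nf t = t" by simp
  with 2 show ?thesis by simp
next
  case 3
  have fac: "fac (TXor (mset_set S)) = mset_set S"
    using assms by (simp add: sum_mset_image_fac_standard)
  have "image_mset nf (mset_set S) = image_mset id (mset_set S)"
    using assms by (intro image_mset_cong) simp
  then have nf: "image_mset nf (mset_set S) = mset_set S" by simp
  have "{v. odd (count (mset_set S) v)} = S"
    using assms(1) by (auto simp: count_mset_set')
  then show ?thesis using 3 by (simp only: nf_TXor fac nf)
qed

text \<open>The summands of a normalized sum are themselves normal forms of factors; by induction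
  they are fixed by \<open>nf\<close>, and they are pairwise distinct.\<close>

lemma nf_nf: "nf (nf t) = nf t"
proof (induction t rule: nf.induct)
  case (7 M)
  let ?S = "{v. odd (count (image_mset nf (fac (TXor M))) v)}"
  have "standard u \<and> nf u = u" if "u \<in> ?S" for u
  proof -
    from that have "u \<in># image_mset nf (fac (TXor M))"
      by (blast dest: odd_count_imp_mem)
    then obtain w where w: "w \<in># fac (TXor M)" "u = nf w" by (auto simp del: fac.simps)
    with 7 show ?thesis by (metis standard_nf standard_if_mem_fac)
  qed
  then show ?case
    unfolding nf_TXor using finite_odd_count by (intro nf_xor_sum_mset_set) auto
qed simp_all

lemma nf_mem_fac_normalized:
  assumes "normalized t" "u \<in># fac t"
  shows "nf u = u"
proof -
  have "u \<in># fac (nf t)" using assms by (simp add: normalized_def)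
  then have "u \<in># image_mset nf (fac t)"
    unfolding mem_fac_nf by (rule odd_count_imp_mem)
  then show ?thesis by (auto simp: nf_nf)
qed

section \<open>Cancellation in the xor rule\<close>

text \<open>On factors of normalized terms \<open>nf\<close> is the identity, so only the parity of
  the total multiplicity matters.\<close>

lemma mem_fac_nf_xor_sum:
  assumes "\<forall>s \<in># M. normalized s"
  shows "v \<in># fac (nf (xor_sum M)) \<longleftrightarrow> odd (count (\<Sum>\<^sub># (image_mset fac M)) v)"
proof -
  let ?F = "\<Sum>\<^sub># (image_mset fac M)"
  have "image_mset nf ?F = image_mset id ?F"
    using assms by (intro image_mset_cong) (auto dest: nf_mem_fac_normalized)
  then show ?thesis by (simp add: mem_fac_nf fac_xor_sum)
qed

lemma xor_premise_cases:
  assumes "\<forall>s \<in> set ts. normalized s" "distinct ts" "s \<in> set ts" "standard s"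
  obtains "s \<in># fac (nf (xor_sum (mset ts)))"
  | s' where "s' \<in> set ts" "\<not> standard s'" "s \<in># fac s'"
proof (cases "s \<in># fac (nf (xor_sum (mset ts)))")
  case True
  then show ?thesis by (rule that)
next
  case False
  let ?R = "mset (remove1 s ts)"
  have ts: "mset ts = add_mset s ?R" using assms(3) by simp
  have "\<not> odd (count (\<Sum>\<^sub># (image_mset fac (mset ts))) s)"
    using False assms(1) by (simp add: mem_fac_nf_xor_sum)
  \<comment> \<open>The standard term \<open>s\<close> contributes exactly one occurrence of itself;
    removing it flips the parity.\<close>
  then have "odd (count (\<Sum>\<^sub># (image_mset fac ?R)) s)"
    unfolding ts using assms(4) by (simp add: fac_eq_single_if_standard)
  then have "s \<in># \<Sum>\<^sub># (image_mset fac ?R)" by (rule odd_count_imp_mem)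
  then obtain s' where s': "s' \<in> set (remove1 s ts)" "s \<in># fac s'"
    by (auto simp del: mset_remove1)
  \<comment> \<open>Distinctness makes the removed occurrence of \<open>s\<close> the only
    one.\<close>
  then have "s' \<in> set ts" "s' \<noteq> s" using assms(2) by auto
  moreover from this s'(2) have "\<not> standard s'" by (auto simp: fac_eq_single_if_standard)
  ultimately show ?thesis using s'(2) that(2) by blast
qed

lemma xor_standard_conclusion:
  assumes "\<forall>s \<in> set ts. normalized s" "c = nf (xor_sum (mset ts))" "standard c" "c \<notin> set ts"
  obtains s where "s \<in> set ts" "\<not> standard s" "c \<in># fac s"
proof -
  have "c \<in># fac (nf (xor_sum (mset ts)))"
    using fac_eq_single_if_standard[OF assms(3)] unfolding assms(2)[symmetric] by simp
  then have "odd (count (\<Sum>\<^sub># (image_mset fac (mset ts))) c)"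
    using assms(1) by (simp add: mem_fac_nf_xor_sum)
  then have "c \<in># \<Sum>\<^sub># (image_mset fac (mset ts))" by (rule odd_count_imp_mem)
  then obtain s where s: "s \<in> set ts" "c \<in># fac s" by auto
  moreover from this assms(4) have "\<not> standard s" by (auto simp: fac_eq_single_if_standard)
  ultimately show ?thesis using that by blast
qed

section \<open>Subterm closure\<close>

lemma st_refl: "t \<in> st t"
  by (cases t) auto

lemma fac_subset_st: "u \<in># fac t \<Longrightarrow> u \<in> st t"
  by (cases t) (auto simp del: fac.simps(7) intro: st_refl split: if_splits)

lemma st_trans: "u \<in> st t \<Longrightarrow> st u \<subseteq> st t"
proof (induction t rule: st.induct)
  case (7 M)
  then show ?case by (fastforce simp del: fac.simps)
qed auto

lemma sts_trans: "u \<in> sts X \<Longrightarrow> st u \<subseteq> sts X"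
  using st_trans unfolding sts_def by blast

text \<open>Transfers the induction hypothesis for a premise to \<open>Y\<close>, which will be
  \<open>X\<close> or \<open>X\<close> together with the conclusion.\<close>

lemma sts_insert_subset: "u \<in> sts Y \<Longrightarrow> X \<subseteq> Y \<Longrightarrow> sts (X \<union> {u}) \<subseteq> sts Y"
  using sts_trans[of u Y] unfolding sts_def by auto

section \<open>Induction on normal proofs\<close>

lemma not_constructor_rule: "\<not> constructor_rule r c \<longleftrightarrow> destructor_rule r c"
  by (cases r) (auto simp: constructor_rule_def destructor_rule_def)

lemma conc_mem_terms: "conc p \<in> terms p"
  by (cases p) simp

lemma normalized_conc: "is_proof K p \<Longrightarrow> normalized (conc p)"
  by (cases p) simp

text \<open>The constructors other than \<open>xor\<close> conclude key, pair or encryption terms,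
  all of them standard.\<close>

lemma destructor_if_nonstandard:
  assumes "is_proof K p" "\<not> standard (conc p)" "lr p \<noteq> R_xor"
  shows "destructor_rule (lr p) (conc p)"
  using assms
  by (cases p) (auto simp: destructor_rule_def elim: rule_instance.cases)

text \<open>Both claims are proved in one induction: the destructor claim for premises is what keeps
  them inside \<open>sts X\<close>.\<close>

lemma normal_proof_terms:
  assumes "is_proof K \<pi>" "normal \<pi>" "axioms \<pi> \<subseteq> X"
  shows "terms \<pi> \<subseteq> sts (X \<union> {conc \<pi>}) \<and>
         (destructor_rule (lr \<pi>) (conc \<pi>) \<longrightarrow> terms \<pi> \<subseteq> sts X)"
  using assms
proof (induction \<pi>)
  case (Node t r ps)
  have mono: "sts X \<subseteq> sts (X \<union> {t})" and t_in: "t \<in> sts (X \<union> {t})"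
    using st_refl by (auto simp: sts_def)
  have st_t: "u \<in> sts (X \<union> {t})" if "u \<in> st t" for u
    using that by (auto simp: sts_def)
  have ax: "axioms p \<subseteq> X" if "p \<in> set ps" for p
    using that Node.prems(3) by (auto split: if_splits)
  have IH: "terms p \<subseteq> sts (X \<union> {conc p})"
    and IHd: "destructor_rule (lr p) (conc p) \<Longrightarrow> terms p \<subseteq> sts X"
    if "p \<in> set ps" for p
    using Node.IH[OF that] Node.prems that ax[OF that] by auto
  have sub: "terms p \<subseteq> sts Y" if "p \<in> set ps" "conc p \<in> sts Y" "X \<subseteq> Y" for p Y
    using IH[OF that(1)] sts_insert_subset[OF that(2,3)] by blast
  have inst: "rule_instance r (map conc ps) t" using Node.prems(1) by simp
  \<comment> \<open>Two closing patterns follow: \<open>destr\<close> yields both claims at once,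
    while in \<open>constr\<close> the second claim is vacuous.\<close>
  have destr: ?case if "t \<in> sts X" "\<And>p. p \<in> set ps \<Longrightarrow> conc p \<in> sts X"
    using that sub[of _ X] mono by fastforce
  have constr: ?case
    if "\<And>p. p \<in> set ps \<Longrightarrow> conc p \<in> sts (X \<union> {t})" "\<not> destructor_rule r t"
    using that sub[of _ "X \<union> {t}"] t_in by fastforce
  \<comment> \<open>Normality forces a destructor above the leftmost premise, so the induction
    hypothesis places it in \<open>sts X\<close>. The other premise and the conclusion are subterms
    of it.\<close>
  have major: "conc (hd ps) \<in> sts X" if "r \<in> {R_split, R_sdec, R_adec}" "ps \<noteq> []"
  proof -
    have "hd ps \<in> set ps" using that(2) by simp
    moreover have "destructor_rule (lr (hd ps)) (conc (hd ps))"
      using that Node.prems(2) not_constructor_rule by (metis normal.simps)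
    ultimately show ?thesis using IHd conc_mem_terms by blast
  qed
  show ?case
  proof (cases "r = R_xor")
    case False
    from inst False show ?thesis
    proof cases
      case 1
      then have "t \<in> X" using Node.prems(3) by simp
      with 1 show ?thesis by (intro destr) (auto simp: sts_def intro: st_refl)
    next
      case (2 t2)
      then have "TPair t t2 \<in> sts X" using major by force
      with 2 show ?thesis using sts_trans st_refl by (intro destr) (force simp: map_eq_Cons_conv)+
    next
      case (3 t1)
      then have "TPair t1 t \<in> sts X" using major by force
      with 3 show ?thesis using sts_trans st_refl by (intro destr) (force simp: map_eq_Cons_conv)+
    next
      case (4 v)
      then have "TSEnc t v \<in> sts X" using major by force
      with 4 show ?thesis using sts_trans st_refl by (intro destr) (force simp: map_eq_Cons_conv)+
    next
      case (5 k)
      then have "TAEnc t k \<in> sts X" using major by force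
      with 5 show ?thesis using sts_trans st_refl by (intro destr) (force simp: map_eq_Cons_conv)+
    \<comment> \<open>For \<open>pk\<close>, \<open>pair\<close>, \<open>senc\<close> and
      \<open>aenc\<close> every premise is a subterm of \<open>t\<close>.\<close>
    qed (intro constr st_t; auto simp: map_eq_Cons_conv destructor_rule_def st_refl)+
  next
    case True
    let ?ts = "map conc ps"
    have t: "t = nf (xor_sum (mset ?ts))"
      using inst True by (auto elim: rule_instance.cases)
    have normd: "\<forall>s \<in> set ?ts. normalized s" using Node.prems(1) normalized_conc by auto
    have dist: "distinct ?ts" and t_notin: "t \<notin> set ?ts"
      and no_xor: "\<And>p. p \<in> set ps \<Longrightarrow> lr p \<noteq> R_xor"
      using Node.prems(2) True by auto
    have nonstd: "s \<in> sts X" if s: "s \<in> set ?ts" "\<not> standard s" for s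
    proof -
      obtain p where p: "p \<in> set ps" "s = conc p" using s(1) by auto
      then have "destructor_rule (lr p) (conc p)"
        using s(2) Node.prems(1) no_xor by (intro destructor_if_nonstandard[of K]) auto
      then show ?thesis using IHd[OF p(1)] conc_mem_terms p(2) by blast
    qed
    have fac_nonstd: "u \<in> sts X" if "s \<in> set ?ts" "\<not> standard s" "u \<in># fac s" for s u
      using nonstd[OF that(1,2)] fac_subset_st[OF that(3)] sts_trans by blast
    have premise: "s \<in> sts X \<or> s \<in># fac t" if "s \<in> set ?ts" for s
    proof (cases "standard s")
      case std: True
      from normd dist that std show ?thesis
        by (cases rule: xor_premise_cases) (use t fac_nonstd in auto)
    next
      case False
      with that show ?thesis using nonstd by blast
    qed
    show ?thesis
    proof (cases "standard t")
      case std: True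
      from normd t std t_notin obtain s where "s \<in> set ?ts" "\<not> standard s" "t \<in># fac s"
        by (rule xor_standard_conclusion)
      then have "t \<in> sts X" by (rule fac_nonstd)
      \<comment> \<open>The only factor of a standard \<open>t\<close> is \<open>t\<close> itself,
        which is not a premise, so no premise survives as a factor.\<close>
      moreover have "s \<in> sts X" if "s \<in> set ?ts" for s
        using premise[OF that] t_notin that std by (auto simp: fac_eq_single_if_standard)
      ultimately show ?thesis by (intro destr) auto
    next
      case nonstd_t: False
      \<comment> \<open>A surviving premise is a factor, hence a subterm, of
        \<open>t\<close>.\<close>
      have "s \<in> sts (X \<union> {t})" if "s \<in> set ?ts" for s
        using premise[OF that] mono fac_subset_st st_t by blast
      with nonstd_t True show ?thesis by (intro constr) (auto simp: destructor_rule_def)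
    qed
  qed
qed

theorem mainTheorem3:
  fixes K :: "'n::names set"
    and X :: "('n, 'v) trm set"
    and \<pi> :: "('n, 'v) ptree"
    and t :: "('n, 'v) trm"
  assumes "X \<subseteq> wf_terms K"
    and "is_proof K \<pi>"
    and "normal \<pi>"
    and "axioms \<pi> \<subseteq> X"
    and "conc \<pi> = t"
  shows "terms \<pi> \<subseteq> sts (X \<union> {t}) \<and>
         (destructor_rule (lr \<pi>) (conc \<pi>) \<longrightarrow> terms \<pi> \<subseteq> sts X)"
  using normal_proof_terms[OF assms(2-4)] assms(5) by simp

end
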